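(* Let $1\leq m\leq n/2$. The sets $$T(n,m)\times\prod_{X\in B(n)_{m-1}}\mathcal{DU}(X)\qquad\text{and}\qquad T(n,m-1)\times\prod_{X\in B(n)_m}\mathcal{UD}(X)$$ have the same cardinality.
   Context: $B(n)_k$ is the set of $k$-element subsets of $\{1,\ldots,n\}$. For $0\leq m\leq n/2$, the Johnson graph $C(n,m)$ has vertex set $B(n)_m$, with $X,Y$ adjacent iff $|X\cap Y|=m-1$. A rooted spanning tree of a graph is a spanning tree together with a choice of a vertex as root; $T(n,m)$ is the set of rooted spanning trees of $C(n,m)$. For $1\leq k\leq n$, $X\in B(n)_k$, $X'\in B(n)_{k-1}$: $\mathcal{UD}(X)=\{(Y,Z)\in B(n)_{k-1}\times B(n)_k: X\supseteq Y\subseteq Z\}$ and $\mathcal{DU}(X')=\{(Y',Z')\in B(n)_k\times B(n)_{k-1}: X'\subseteq Y'\supseteq Z'\}$. The products are Cartesian products. *)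

theory Defs
  imports Main "HOL-Library.FuncSet" "HOL-Library.Equipollence"
begin

text \<open>
  A finite simple undirected graph is given by its vertex set \<open>V\<close> and its edge set \<open>E\<close>, a set of
  two-element subsets of \<open>V\<close>.
\<close>

definition connected_graph :: "'a set \<Rightarrow> 'a set set \<Rightarrow> bool" where
  "connected_graph V E \<longleftrightarrow>
     V \<noteq> {} \<and> (\<forall>u\<in>V. \<forall>v\<in>V. (u, v) \<in> {(x, y). x \<in> V \<and> y \<in> V \<and> {x, y} \<in> E}\<^sup>*)"

definition graph_cycle :: "'a set set \<Rightarrow> 'a list \<Rightarrow> bool" where
  "graph_cycle E c \<longleftrightarrow>
     length c \<ge> 3 \<and> distinct c \<and>
     (\<forall>i<length c. {c ! i, c ! (Suc i mod length c)} \<in> E)"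

definition is_tree :: "'a set \<Rightarrow> 'a set set \<Rightarrow> bool" where
  "is_tree V E \<longleftrightarrow> connected_graph V E \<and> (\<nexists>c. graph_cycle E c)"

text \<open>A spanning tree has the same vertex set as the graph, so it is determined by its edges.\<close>

definition spanning_tree :: "'a set \<Rightarrow> 'a set set \<Rightarrow> 'a set set \<Rightarrow> bool" where
  "spanning_tree V E F \<longleftrightarrow> F \<subseteq> E \<and> is_tree V F"

definition rooted_spanning_trees :: "'a set \<Rightarrow> 'a set set \<Rightarrow> ('a set set \<times> 'a) set" where
  "rooted_spanning_trees V E = {(F, r). spanning_tree V E F \<and> r \<in> V}"

definition B :: "nat \<Rightarrow> nat \<Rightarrow> nat set set" where
  "B n k = {X. X \<subseteq> {1..n} \<and> card X = k}"

text \<open>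
  The intersection condition is stated over the integers: with truncated subtraction, the
  single vertex \<open>{}\<close> of the graph for \<open>m = 0\<close> would be adjacent to itself.
\<close>

definition johnson_edges :: "nat \<Rightarrow> nat \<Rightarrow> nat set set set" where
  "johnson_edges n m =
     {{X, Y} | X Y. X \<in> B n m \<and> Y \<in> B n m \<and> int (card (X \<inter> Y)) = int m - 1}"

lemma card_johnson_edge:
  assumes "e \<in> johnson_edges n m"
  shows "e \<subseteq> B n m" and "card e = 2"
proof -
  obtain X Y where e: "e = {X, Y}" "X \<in> B n m" "Y \<in> B n m" "int (card (X \<inter> Y)) = int m - 1"
    using assms by (auto simp: johnson_edges_def)
  then have "X \<noteq> Y"
    by (auto simp: B_def)
  with e show "e \<subseteq> B n m" "card e = 2"
    by auto
qed

definition T :: "nat \<Rightarrow> nat \<Rightarrow> (nat set set set \<times> nat set) set" where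
  "T n m = rooted_spanning_trees (B n m) (johnson_edges n m)"

text \<open>
  Both definitions below are meant for \<open>1 \<le> k \<le> n\<close>, with \<open>X\<close> in \<open>B n k\<close> for \<open>UD\<close> and in
  \<open>B n (k - 1)\<close> for \<open>DU\<close>.
\<close>

definition UD :: "nat \<Rightarrow> nat \<Rightarrow> nat set \<Rightarrow> (nat set \<times> nat set) set" where
  "UD n k X = {(Y, Z) \<in> B n (k - 1) \<times> B n k. X \<supseteq> Y \<and> Y \<subseteq> Z}"

definition DU :: "nat \<Rightarrow> nat \<Rightarrow> nat set \<Rightarrow> (nat set \<times> nat set) set" where
  "DU n k X = {(Y, Z) \<in> B n k \<times> B n (k - 1). X \<subseteq> Y \<and> Y \<supseteq> Z}"

end

theory Submission
  imports Defs "Jordan_Normal_Form.Determinant" "HOL-Computational_Algebra.Polynomial"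
begin

text \<open>
  Let \<open>W\<close> be the inclusion matrix of \<open>B n (m - 1)\<close> against \<open>B n m\<close> and \<open>c = m (n - m + 1)\<close>, which is
  the size of every \<open>UD n m X\<close> and \<open>DU n m X\<close>. The Laplacians of the two Johnson graphs are
  \<open>c I - W\<^sup>T W\<close> and \<open>c I - W W\<^sup>T\<close>, so Sylvester's determinant identity relates the polynomials
  \<open>det (x I + L)\<close> by the factors \<open>(x + c) ^ card (B n (m - 1))\<close> and \<open>(x + c) ^ card (B n m)\<close>. These
  polynomials count rooted spanning forests by their number of roots; comparing the coefficients of
  \<open>x\<close> compares the numbers of rooted spanning trees.
\<close>

section \<open>Parent functions and rooted spanning trees\<close>

text \<open>
  A rooted forest is encoded by its parent function, with value \<open>None\<close> at the roots. Acyclicity is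
  the existence of a potential that decreases towards the parent.
\<close>

definition parent_funs :: "'a set \<Rightarrow> 'a set set \<Rightarrow> ('a \<Rightarrow> 'a option) set" where
  "parent_funs V E = (\<Pi>\<^sub>E v\<in>V. insert None (Some ` {u \<in> V. {v, u} \<in> E}))"

definition forest_fun :: "'a set \<Rightarrow> ('a \<Rightarrow> 'a option) \<Rightarrow> bool" where
  "forest_fun V f \<longleftrightarrow> (\<exists>d :: 'a \<Rightarrow> nat. \<forall>v\<in>V. \<forall>u. f v = Some u \<longrightarrow> d u < d v)"

definition roots :: "'a set \<Rightarrow> ('a \<Rightarrow> 'a option) \<Rightarrow> 'a set" where
  "roots V f = {v \<in> V. f v = None}"

definition tree_funs :: "'a set \<Rightarrow> 'a set set \<Rightarrow> ('a \<Rightarrow> 'a option) set" where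
  "tree_funs V E = {f \<in> parent_funs V E. forest_fun V f \<and> card (roots V f) = 1}"

definition parent_edges :: "'a set \<Rightarrow> ('a \<Rightarrow> 'a option) \<Rightarrow> 'a set set" where
  "parent_edges V f = {{v, u} | v u. v \<in> V \<and> f v = Some u}"

lemma parent_funsD:
  assumes "f \<in> parent_funs V E" "v \<in> V" "f v = Some u"
  shows "u \<in> V" "{v, u} \<in> E"
  using PiE_mem[OF assms(1)[unfolded parent_funs_def] assms(2)] assms(3) by auto

lemma finite_parent_funs: "finite V \<Longrightarrow> finite (parent_funs V E)"
  unfolding parent_funs_def by (intro finite_PiE) auto

lemma parent_edges_subset: "f \<in> parent_funs V E \<Longrightarrow> parent_edges V f \<subseteq> E"
  by (auto simp: parent_edges_def dest: parent_funsD)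

text \<open>A vertex of least potential has no parent, because the parent would lie in
  \<open>V\<close> as well and have smaller potential. In the determinant expansion this makes the
  constant coefficient vanish.\<close>

lemma forest_fun_roots_nonempty:
  assumes "f \<in> parent_funs V E" "forest_fun V f" "V \<noteq> {}"
  shows "roots V f \<noteq> {}"
proof -
  obtain d :: "'a \<Rightarrow> nat" where d: "\<And>v u. v \<in> V \<Longrightarrow> f v = Some u \<Longrightarrow> d u < d v"
    using assms(2) by (auto simp: forest_fun_def)
  obtain v where v: "v \<in> V" "\<And>u. u \<in> V \<Longrightarrow> d v \<le> d u"
    using ex_has_least_nat[of "\<lambda>v. v \<in> V" _ d] assms(3) by blast
  have "f v = None"
  proof (cases "f v")
    case (Some u)
    then show ?thesis
      using d[OF v(1) Some] v(2)[OF parent_funsD(1)[OF assms(1) v(1) Some]] by simp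
  qed simp
  then show ?thesis
    using v(1) by (auto simp: roots_def)
qed

text \<open>Each step to the parent lowers the potential, so the ascent ends at a root; its steps
  are read as undirected edges.\<close>

lemma forest_fun_reaches_root:
  assumes f: "f \<in> parent_funs V E" "forest_fun V f" and v: "v \<in> V"
  shows "\<exists>r \<in> roots V f. (v, r) \<in> {(x, y). x \<in> V \<and> y \<in> V \<and> {x, y} \<in> parent_edges V f}\<^sup>*"
proof -
  obtain d :: "'a \<Rightarrow> nat" where d: "\<And>v u. v \<in> V \<Longrightarrow> f v = Some u \<Longrightarrow> d u < d v"
    using f(2) by (auto simp: forest_fun_def)
  show ?thesis
    using v
  proof (induction "d v" arbitrary: v rule: less_induct)
    case less
    show ?case
    proof (cases "f v")
      case None
      then show ?thesis
        using less.prems by (auto simp: roots_def)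
    next
      case (Some u)
      have u: "u \<in> V"
        using parent_funsD(1)[OF f(1) less.prems Some] .
      from less.hyps[OF d[OF less.prems Some] u]
      obtain r where r: "r \<in> roots V f"
        "(u, r) \<in> {(x, y). x \<in> V \<and> y \<in> V \<and> {x, y} \<in> parent_edges V f}\<^sup>*"
        by blast
      have "(v, u) \<in> {(x, y). x \<in> V \<and> y \<in> V \<and> {x, y} \<in> parent_edges V f}"
        using less.prems u Some by (auto simp: parent_edges_def)
      with r show ?thesis
        by (meson converse_rtrancl_into_rtrancl)
    qed
  qed
qed

lemma connected_parent_edges:
  assumes f: "f \<in> parent_funs V E" "forest_fun V f" and r: "roots V f = {r}"
  shows "connected_graph V (parent_edges V f)"
proof -
  let ?R = "{(x, y). x \<in> V \<and> y \<in> V \<and> {x, y} \<in> parent_edges V f}"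
  have sym: "sym (?R\<^sup>*)"
    by (intro sym_rtrancl) (auto simp: sym_def insert_commute)
  have "(v, r) \<in> ?R\<^sup>*" if "v \<in> V" for v
    using forest_fun_reaches_root[OF f that] r by auto
  then have "(u, v) \<in> ?R\<^sup>*" if "u \<in> V" "v \<in> V" for u v
    using that sym by (meson rtrancl_trans symD)
  moreover have "V \<noteq> {}"
    using r by (auto simp: roots_def)
  ultimately show ?thesis
    by (auto simp: connected_graph_def)
qed

text \<open>On a cycle, both neighbours of a vertex of maximal depth would be its parent.\<close>

lemma acyclic_parent_edges:
  assumes "forest_fun V f"
  shows "\<not> graph_cycle (parent_edges V f) c"
proof
  assume c: "graph_cycle (parent_edges V f) c"
  obtain d :: "'a \<Rightarrow> nat" where d: "\<And>v u. v \<in> V \<Longrightarrow> f v = Some u \<Longrightarrow> d u < d v"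
    using assms by (auto simp: forest_fun_def)
  define l where "l = length c"
  have l: "l \<ge> 3" and dist: "distinct c"
    and edge: "\<And>i. i < l \<Longrightarrow> {c ! i, c ! (Suc i mod l)} \<in> parent_edges V f"
    using c by (auto simp: graph_cycle_def l_def)
  obtain i where i: "i < l" "\<And>j. j < l \<Longrightarrow> d (c ! j) \<le> d (c ! i)"
  proof -
    have "finite ((\<lambda>j. d (c ! j)) ` {..<l})" "(\<lambda>j. d (c ! j)) ` {..<l} \<noteq> {}"
      using l by (auto simp: lessThan_empty_iff)
    from Max_in[OF this] Max_ge[OF this(1)] that show ?thesis
      by fastforce
  qed
  \<comment> \<open>An edge records one endpoint as the parent of the other; the maximality of
    \<open>d (c ! i)\<close> leaves only this direction.\<close>
  have step: "f (c ! i) = Some (c ! j)"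
    if "j < l" "{c ! i, c ! j} \<in> parent_edges V f" for j
  proof -
    from that(2) obtain v u where vu: "{c ! i, c ! j} = {v, u}" "v \<in> V" "f v = Some u"
      by (auto simp: parent_edges_def)
    with d[OF vu(2,3)] i(2)[OF that(1)] show ?thesis
      by (auto simp: doubleton_eq_iff)
  qed
  \<comment> \<open>\<open>j\<close> and \<open>k\<close> are the cyclic successor and predecessor
    of \<open>i\<close>; they differ because the cycle has length at least 3.\<close>
  define j where "j = Suc i mod l"
  define k where "k = (if i = 0 then l - 1 else i - 1)"
  have jk: "j < l" "k < l" "j \<noteq> k" "Suc k mod l = i"
    using l i(1) by (auto simp: j_def k_def mod_Suc)
  have "f (c ! i) = Some (c ! j)"
    using step[OF jk(1)] edge[OF i(1)] by (simp add: j_def)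
  moreover have "f (c ! i) = Some (c ! k)"
    using step[OF jk(2)] edge[OF jk(2)] jk(4) by (simp add: insert_commute)
  ultimately have "c ! j = c ! k"
    by simp
  with jk dist show False
    by (simp add: nth_eq_iff_index_eq l_def)
qed

text \<open>The edges and the root determine the orientation, by induction on the potential of
  \<open>f\<close>. If \<open>f v = Some u\<close>, then \<open>g v = Some u\<close> or
  \<open>g u = Some v\<close>; in the second case the induction hypothesis \<open>f u = g u\<close>
  would give \<open>f u = Some v\<close>, against \<open>d u < d v\<close>.\<close>

lemma parent_edges_inj:
  assumes f: "f \<in> parent_funs V E" "forest_fun V f" "roots V f = {r}"
    and g: "g \<in> parent_funs V E" "roots V g = {r}"
    and eq: "parent_edges V f = parent_edges V g"
  shows "f = g"
proof -
  obtain d :: "'a \<Rightarrow> nat" where d: "\<And>v u. v \<in> V \<Longrightarrow> f v = Some u \<Longrightarrow> d u < d v"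
    using f(2) by (auto simp: forest_fun_def)
  have "f v = g v" if "v \<in> V" for v
    using that
  proof (induction "d v" arbitrary: v rule: less_induct)
    case less
    show ?case
    proof (cases "f v")
      case None
      then have "v \<in> roots V g"
        using less.prems f(3) g(2) by (auto simp: roots_def)
      with None show ?thesis
        by (simp add: roots_def)
    next
      case (Some u)
      have u: "u \<in> V"
        using parent_funsD(1)[OF f(1) less.prems Some] .
      have IH: "f u = g u"
        using less.hyps[OF d[OF less.prems Some] u] .
      have "{v, u} \<in> parent_edges V f"
        using less.prems Some by (auto simp: parent_edges_def)
      then have "{v, u} \<in> parent_edges V g"
        by (simp only: eq)
      then have "g v = Some u \<or> g u = Some v"
        by (auto simp: parent_edges_def doubleton_eq_iff)
      moreover have "f u \<noteq> Some v"
        using d[OF less.prems Some] d[OF u] by force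
      ultimately show ?thesis
        using IH Some by auto
    qed
  qed
  then show ?thesis
    using f(1) g(1) by (auto simp: parent_funs_def intro: PiE_ext)
qed

section \<open>Simple paths, cycles, and orienting a spanning tree towards its root\<close>

lemma rtrancl_distinct_path:
  assumes "(x, y) \<in> R\<^sup>*"
  shows "\<exists>p. p \<noteq> [] \<and> hd p = x \<and> last p = y \<and> distinct p \<and> successively (\<lambda>a b. (a, b) \<in> R) p"
  using assms
proof (induction rule: converse_rtrancl_induct)
  case base
  then show ?case
    by (intro exI[of _ "[y]"]) auto
next
  case (step x z)
  then obtain p where p: "p \<noteq> []" "hd p = z" "last p = y" "distinct p"
    "successively (\<lambda>a b. (a, b) \<in> R) p"
    by blast
  show ?case
  proof (cases "x \<in> set p")
    case True
    \<comment> \<open>The detour \<open>p1\<close> before the earlier occurrence of \<open>x\<close>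
      is dropped, so no vertex is repeated.\<close>
    then obtain p1 p2 where "p = p1 @ x # p2"
      by (meson split_list)
    with p show ?thesis
      by (intro exI[of _ "x # p2"]) (auto simp: successively_append_iff)
  next
    case False
    with p step.hyps show ?thesis
      by (intro exI[of _ "x # p"]) (auto simp: successively_Cons)
  qed
qed

text \<open>The edge closes a simple path in \<open>F'\<close> between its ends to a cycle. The path
  has at least three vertices: \<open>x \<noteq> y\<close> excludes one, and
  \<open>{x, y} \<notin> F'\<close> excludes two.\<close>

lemma graph_cycle_if_connected_edge:
  assumes "(x, y) \<in> {(x, y). x \<in> V \<and> y \<in> V \<and> {x, y} \<in> F'}\<^sup>*"
    and "x \<noteq> y" "{x, y} \<in> F" "{x, y} \<notin> F'" "F' \<subseteq> F"
  shows "\<exists>c. graph_cycle F c"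
proof -
  from rtrancl_distinct_path[OF assms(1)] obtain p where
    p: "p \<noteq> []" "hd p = x" "last p = y" "distinct p"
      "successively (\<lambda>a b. (a, b) \<in> {(x, y). x \<in> V \<and> y \<in> V \<and> {x, y} \<in> F'}) p"
    by blast
  have 1: "{p ! i, p ! Suc i} \<in> F'" if "Suc i < length p" for i
    using p(5) that by (auto simp: successively_conv_nth)
  have xy: "p ! 0 = x" "p ! (length p - 1) = y"
    using p by (auto simp: hd_conv_nth last_conv_nth)
  have "length p \<noteq> 0" "length p \<noteq> 1"
    using p(1) xy assms(2) by auto
  moreover have "length p \<noteq> 2"
    using 1[of 0] xy assms(4) by auto
  ultimately have len: "length p \<ge> 3"
    by linarith
  have "{p ! i, p ! (Suc i mod length p)} \<in> F" if "i < length p" for i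
  proof (cases "Suc i < length p")
    case True
    then show ?thesis
      using 1 assms(5) by auto
  next
    case False
    \<comment> \<open>At the last index the successor wraps around to the start of \<open>p\<close>;
      this is the closing edge.\<close>
    then have "i = length p - 1" "Suc i mod length p = 0"
      using that by (auto simp: mod_Suc)
    then show ?thesis
      using xy assms(3) by (simp add: insert_commute)
  qed
  with len p(4) show ?thesis
    by (auto simp: graph_cycle_def)
qed

text \<open>Every vertex other than \<open>r\<close> takes as parent a neighbour in \<open>F\<close>
  that is closer to \<open>r\<close>.\<close>

lemma ex_tree_fun:
  assumes E: "\<And>e. e \<in> E \<Longrightarrow> e \<subseteq> V \<and> card e = 2"
    and F: "spanning_tree V E F" and r: "r \<in> V"
  shows "\<exists>f \<in> parent_funs V E. forest_fun V f \<and> roots V f = {r} \<and> parent_edges V f = F"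
proof -
  define R where "R = {(x, y). x \<in> V \<and> y \<in> V \<and> {x, y} \<in> F}"
  have F': "F \<subseteq> E" "connected_graph V F" "\<And>c. \<not> graph_cycle F c"
    using F by (auto simp: spanning_tree_def is_tree_def)
  have reach: "\<exists>k. (v, r) \<in> R ^^ k" if "v \<in> V" for v
    using F'(2) that r by (auto simp: connected_graph_def R_def dest: rtrancl_imp_relpow)
  \<comment> \<open>The distance to \<open>r\<close> inside \<open>F\<close>, which becomes the
    potential of \<open>f\<close>.\<close>
  define d where "d v = (LEAST k. (v, r) \<in> R ^^ k)" for v
  have closer: "\<exists>u. (v, u) \<in> R \<and> d u < d v" if v: "v \<in> V" "v \<noteq> r" for v
  proof -
    have dv: "(v, r) \<in> R ^^ d v"
      using LeastI_ex[OF reach[OF v(1)]] by (simp add: d_def)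
    with v(2) obtain k where k: "d v = Suc k"
      by (cases "d v") auto
    obtain u where u: "(v, u) \<in> R" "(u, r) \<in> R ^^ k"
      using relpow_Suc_D2[OF dv[unfolded k]] by blast
    then have "d u \<le> k"
      by (auto simp: d_def intro: Least_le)
    with k u show ?thesis
      by auto
  qed
  define p where "p v = (SOME u. (v, u) \<in> R \<and> d u < d v)" for v
  have p: "(v, p v) \<in> R" "d (p v) < d v" if "v \<in> V" "v \<noteq> r" for v
    using someI_ex[OF closer[OF that]] by (auto simp: p_def)
  define f where "f = (\<lambda>v\<in>V. if v = r then None else Some (p v))"
  have f: "f \<in> parent_funs V E"
    unfolding parent_funs_def f_def using p(1) F'(1)
    by (intro restrict_PiE_iff[THEN iffD2] ballI) (auto simp: R_def split: if_splits)
  have forest: "forest_fun V f"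
    using p(2) by (auto simp: forest_fun_def f_def intro!: exI[of _ d])
  have roots: "roots V f = {r}"
    using r by (auto simp: roots_def f_def)
  have sub: "parent_edges V f \<subseteq> F"
    using p(1) by (auto simp: parent_edges_def f_def R_def split: if_splits)
  \<comment> \<open>The parent edges already connect \<open>V\<close>, so any further edge of
    \<open>F\<close> would close a cycle in \<open>F\<close>.\<close>
  have "F \<subseteq> parent_edges V f"
  proof
    fix e assume e: "e \<in> F"
    then obtain x y where xy: "e = {x, y}" "x \<noteq> y" "x \<in> V" "y \<in> V"
      using E F'(1) by (metis card_2_iff insert_subset subsetD)
    show "e \<in> parent_edges V f"
    proof (rule ccontr)
      assume "e \<notin> parent_edges V f"
      moreover have "(x, y) \<in> {(x, y). x \<in> V \<and> y \<in> V \<and> {x, y} \<in> parent_edges V f}\<^sup>*"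
        using connected_parent_edges[OF f forest roots] xy by (auto simp: connected_graph_def)
      ultimately have "\<exists>c. graph_cycle F c"
        using graph_cycle_if_connected_edge[of x y V "parent_edges V f" F] xy e sub by auto
      then show False
        using F'(3) by blast
    qed
  qed
  with sub f forest roots show ?thesis
    by blast
qed

text \<open>Orienting the edges of a spanning tree towards its root gives a parent function with
  that single root; the inverse forgets the orientation and keeps the root.\<close>

lemma card_rooted_spanning_trees:
  assumes E: "\<And>e. e \<in> E \<Longrightarrow> e \<subseteq> V \<and> card e = 2"
  shows "card (rooted_spanning_trees V E) = card (tree_funs V E)"
proof -
  let ?h = "\<lambda>f. (parent_edges V f, the_elem (roots V f))"
  have tree_fun_iff: "f \<in> tree_funs V E \<longleftrightarrow>
      f \<in> parent_funs V E \<and> forest_fun V f \<and> (\<exists>r. roots V f = {r})" for f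
    by (auto simp: tree_funs_def card_1_singleton_iff)
  have "inj_on ?h (tree_funs V E)"
    by (intro inj_onI) (auto simp: tree_fun_iff intro: parent_edges_inj)
  moreover have "?h ` tree_funs V E = rooted_spanning_trees V E"
  proof (intro equalityI subsetI)
    fix z assume "z \<in> ?h ` tree_funs V E"
    then obtain f r where f: "f \<in> parent_funs V E" "forest_fun V f" "roots V f = {r}"
      and z: "z = (parent_edges V f, r)"
      by (auto simp: tree_fun_iff)
    have "r \<in> V"
      using f(3) by (auto simp: roots_def)
    then show "z \<in> rooted_spanning_trees V E"
      using connected_parent_edges[OF f] acyclic_parent_edges[OF f(2)] parent_edges_subset[OF f(1)]
      by (auto simp: z rooted_spanning_trees_def spanning_tree_def is_tree_def)
  next
    fix z assume "z \<in> rooted_spanning_trees V E"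
    then obtain F r where z: "z = (F, r)" "spanning_tree V E F" "r \<in> V"
      by (auto simp: rooted_spanning_trees_def)
    from ex_tree_fun[OF E z(2,3)] obtain f where
      "f \<in> parent_funs V E" "forest_fun V f" "roots V f = {r}" "parent_edges V f = F"
      by blast
    then show "z \<in> ?h ` tree_funs V E"
      by (intro image_eqI[of _ _ f]) (auto simp: z(1) tree_fun_iff)
  qed
  ultimately show ?thesis
    using card_image by metis
qed

section \<open>The forest expansion of the Laplacian determinant\<close>

text \<open>The block matrix \<open>?M\<close> is brought to block triangular form in two ways.
  Right multiplication by \<open>?L\<close>, of determinant 1, shows
  \<open>det ?M = det (y I - A C)\<close>; left multiplication by \<open>?K\<close>, of determinant
  \<open>y ^ m\<close>, gives \<open>y ^ n * det (y I - C A)\<close>. Nothing is divided by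
  \<open>y\<close>, which will be a polynomial.\<close>

lemma det_sylvester:
  fixes A :: "'a :: idom mat"
  assumes A: "A \<in> carrier_mat n m" and C: "C \<in> carrier_mat m n"
  shows "det (y \<cdot>\<^sub>m 1\<^sub>m n - A * C) * y ^ m = det (y \<cdot>\<^sub>m 1\<^sub>m m - C * A) * y ^ n"
proof -
  let ?M = "four_block_mat (y \<cdot>\<^sub>m 1\<^sub>m n) A C (1\<^sub>m m)"
  let ?L = "four_block_mat (1\<^sub>m n) (0\<^sub>m n m) (- C) (1\<^sub>m m)"
  let ?K = "four_block_mat (1\<^sub>m n) (0\<^sub>m n m) (- C) (y \<cdot>\<^sub>m 1\<^sub>m m)"
  have M: "?M \<in> carrier_mat (n + m) (n + m)"
    and L: "?L \<in> carrier_mat (n + m) (n + m)"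
    and K: "?K \<in> carrier_mat (n + m) (n + m)"
    by auto
  have "?M * ?L = four_block_mat (y \<cdot>\<^sub>m 1\<^sub>m n * 1\<^sub>m n + A * - C) (y \<cdot>\<^sub>m 1\<^sub>m n * 0\<^sub>m n m + A * 1\<^sub>m m)
      (C * 1\<^sub>m n + 1\<^sub>m m * - C) (C * 0\<^sub>m n m + 1\<^sub>m m * 1\<^sub>m m)"
    using A C by (intro mult_four_block_mat) auto
  also have "\<dots> = four_block_mat (y \<cdot>\<^sub>m 1\<^sub>m n - A * C) A (0\<^sub>m m n) (1\<^sub>m m)"
  proof (intro arg_cong4[where f = four_block_mat])
    show "y \<cdot>\<^sub>m 1\<^sub>m n * 1\<^sub>m n + A * - C = y \<cdot>\<^sub>m 1\<^sub>m n - A * C"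
      using A C by (intro eq_matI) auto
    show "y \<cdot>\<^sub>m 1\<^sub>m n * 0\<^sub>m n m + A * 1\<^sub>m m = A" "C * 1\<^sub>m n + 1\<^sub>m m * - C = 0\<^sub>m m n"
      "C * 0\<^sub>m n m + 1\<^sub>m m * 1\<^sub>m m = 1\<^sub>m m"
      using A C by (auto intro!: eq_matI)
  qed
  finally have lower: "?M * ?L = four_block_mat (y \<cdot>\<^sub>m 1\<^sub>m n - A * C) A (0\<^sub>m m n) (1\<^sub>m m)" .
  have "det (?M * ?L) = det (y \<cdot>\<^sub>m 1\<^sub>m n - A * C)"
    unfolding lower using A C
    by (subst det_four_block_mat_lower_left_zero[where n = n and m = m]) auto
  moreover have "det ?L = 1"
    using C by (subst det_four_block_mat_upper_right_zero[where n = n and m = m]) auto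
  ultimately have detM: "det ?M = det (y \<cdot>\<^sub>m 1\<^sub>m n - A * C)"
    using det_mult[OF M L] by simp
  have "?K * ?M = four_block_mat (1\<^sub>m n * (y \<cdot>\<^sub>m 1\<^sub>m n) + 0\<^sub>m n m * C) (1\<^sub>m n * A + 0\<^sub>m n m * 1\<^sub>m m)
      (- C * (y \<cdot>\<^sub>m 1\<^sub>m n) + y \<cdot>\<^sub>m 1\<^sub>m m * C) (- C * A + y \<cdot>\<^sub>m 1\<^sub>m m * 1\<^sub>m m)"
    using A C by (intro mult_four_block_mat) auto
  also have "\<dots> = four_block_mat (y \<cdot>\<^sub>m 1\<^sub>m n) A (0\<^sub>m m n) (y \<cdot>\<^sub>m 1\<^sub>m m - C * A)"
  proof (intro arg_cong4[where f = four_block_mat])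
    have "- C * (y \<cdot>\<^sub>m 1\<^sub>m n) = - (y \<cdot>\<^sub>m C)" "y \<cdot>\<^sub>m 1\<^sub>m m * C = y \<cdot>\<^sub>m C"
      using C by (simp_all add: mult_smult_distrib[where nr = m and n = n and nc = n]
          mult_smult_assoc_mat[where nr = m and n = m and nc = n]
          right_mult_one_mat' left_mult_one_mat') (auto intro!: eq_matI)
    then show "- C * (y \<cdot>\<^sub>m 1\<^sub>m n) + y \<cdot>\<^sub>m 1\<^sub>m m * C = 0\<^sub>m m n"
      using C by (auto intro!: eq_matI)
    show "- C * A + y \<cdot>\<^sub>m 1\<^sub>m m * 1\<^sub>m m = y \<cdot>\<^sub>m 1\<^sub>m m - C * A"
      using A C by (intro eq_matI) auto
    show "1\<^sub>m n * (y \<cdot>\<^sub>m 1\<^sub>m n) + 0\<^sub>m n m * C = y \<cdot>\<^sub>m 1\<^sub>m n" "1\<^sub>m n * A + 0\<^sub>m n m * 1\<^sub>m m = A"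
      using A C by (auto intro!: eq_matI)
  qed
  finally have upper: "?K * ?M = four_block_mat (y \<cdot>\<^sub>m 1\<^sub>m n) A (0\<^sub>m m n) (y \<cdot>\<^sub>m 1\<^sub>m m - C * A)" .
  have "det (?K * ?M) = y ^ n * det (y \<cdot>\<^sub>m 1\<^sub>m m - C * A)"
    unfolding upper using A C
    by (subst det_four_block_mat_lower_left_zero[where n = n and m = m]) auto
  moreover have "det ?K = y ^ m"
    using C by (subst det_four_block_mat_upper_right_zero[where n = n and m = m]) auto
  ultimately show ?thesis
    using det_mult[OF K M] detM by (simp add: mult.commute)
qed

section \<open>The determinant attached to a single parent function\<close>

lemma permutes_eq_id_if_potential:
  fixes d :: "'b \<Rightarrow> nat"
  assumes p: "p permutes S" "finite S"
    and le: "\<And>i. i \<in> S \<Longrightarrow> p i \<noteq> i \<Longrightarrow> d (p i) < d i"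
  shows "p = id"
proof (rule ccontr)
  assume "p \<noteq> id"
  then obtain i where i: "p i \<noteq> i"
    by (auto simp: fun_eq_iff)
  then have iS: "i \<in> S"
    using p(1) by (auto simp: permutes_def)
  \<comment> \<open>A permutation preserves the total potential, whereas this one would lower
    it.\<close>
  have "sum (\<lambda>i. d (p i)) S < sum d S"
  proof (rule sum_strict_mono_ex1)
    show "\<forall>i\<in>S. d (p i) \<le> d i"
      using le by (metis eq_refl less_imp_le)
    show "\<exists>i\<in>S. d (p i) < d i"
      using le i iS by blast
  qed fact
  moreover have "sum (\<lambda>i. d (p i)) S = sum d S"
    using sum.permute[OF p(1), of d] by (simp add: o_def)
  ultimately show False
    by simp
qed

text \<open>The number of steps from a vertex to its root. It is a relation because an arbitrary
  parent function may run into a cycle, and then no depth exists.\<close>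

inductive root_depth :: "('a \<Rightarrow> 'a option) \<Rightarrow> 'a \<Rightarrow> nat \<Rightarrow> bool" for f where
  "f v = None \<Longrightarrow> root_depth f v 0"
| "f v = Some u \<Longrightarrow> root_depth f u k \<Longrightarrow> root_depth f v (Suc k)"

lemma root_depth_Some:
  "f v = Some u \<Longrightarrow> root_depth f v k \<longleftrightarrow> (\<exists>l. k = Suc l \<and> root_depth f u l)"
  by (subst root_depth.simps) auto

lemma root_depth_unique: "root_depth f v k \<Longrightarrow> root_depth f v l \<Longrightarrow> k = l"
proof (induction arbitrary: l rule: root_depth.induct)
  case (1 v)
  then show ?case
    by (auto elim: root_depth.cases)
next
  case (2 v u k)
  obtain l' where "l = Suc l'" "root_depth f u l'"
    using root_depth_Some[THEN iffD1, OF "2.hyps"(1) "2.prems"] by blast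
  with "2.IH" show ?case
    by blast
qed

text \<open>The depth itself is a potential, since a parent has depth one less. Contrapositively, a
  parent function that is not a forest has a vertex without depth.\<close>

lemma forest_fun_if_root_depth:
  assumes f: "f \<in> parent_funs V E" and ex: "\<And>v. v \<in> V \<Longrightarrow> \<exists>k. root_depth f v k"
  shows "forest_fun V f"
proof -
  define d where "d v = (THE k. root_depth f v k)" for v
  have d: "d v = k" if "root_depth f v k" for v k
    unfolding d_def using that by (intro the_equality) (auto dest: root_depth_unique)
  have "d u < d v" if vu: "v \<in> V" "f v = Some u" for v u
  proof -
    obtain k where k: "root_depth f u k"
      using ex parent_funsD(1)[OF f vu] by blast
    from d[OF k] d[OF root_depth.intros(2)[of f v u, OF vu(2) k]] show ?thesis
      by simp
  qed
  then show ?thesis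
    by (auto simp: forest_fun_def)
qed

text \<open>The matrix is the identity minus the adjacency matrix of the arrows from vertices to
  parents. For a forest only the identity permutation survives in the Leibniz formula, and its
  diagonal entries are 1; otherwise the matrix is singular.\<close>

lemma det_parent_mat:
  fixes h :: "nat \<Rightarrow> 'a"
  assumes h: "bij_betw h {0..<N} V" and f: "f \<in> parent_funs V E"
    and loop_free: "\<And>v. {v} \<notin> E"
  shows "det (mat N N (\<lambda>(i, j). of_bool (i = j) - of_bool (f (h i) = Some (h j))) :: 'b :: idom mat)
    = of_bool (forest_fun V f)"
proof -
  let ?A = "mat N N (\<lambda>(i, j). of_bool (i = j) - of_bool (f (h i) = Some (h j))) :: 'b mat"
  have hV: "h i \<in> V" if "i < N" for i
    using h that by (auto simp: bij_betw_def)
  have loop: "f v \<noteq> Some v" if "v \<in> V" for v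
    using parent_funsD(2)[OF f that, of v] loop_free by auto
  show ?thesis
  proof (cases "forest_fun V f")
    case True
    then obtain d :: "'a \<Rightarrow> nat" where d: "\<And>v u. v \<in> V \<Longrightarrow> f v = Some u \<Longrightarrow> d u < d v"
      by (auto simp: forest_fun_def)
    \<comment> \<open>A nontrivial permutation moves some index without lowering the potential; that
      index is not sent to its parent, and its matrix entry is 0.\<close>
    have zero: "signof p * (\<Prod>i = 0..<N. ?A $$ (i, p i)) = 0"
      if p: "p permutes {0..<N}" "p \<noteq> id" for p
    proof -
      have "\<exists>i\<in>{0..<N}. p i \<noteq> i \<and> \<not> d (h (p i)) < d (h i)"
        using permutes_eq_id_if_potential[OF p(1), of "\<lambda>i. d (h i)"] p(2) by blast
      then obtain i where i: "i \<in> {0..<N}" "p i \<noteq> i" "\<not> d (h (p i)) < d (h i)"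
        by blast
      have "f (h i) \<noteq> Some (h (p i))"
        using d hV i by auto
      moreover have "p i < N"
        using i(1) permutes_in_image[OF p(1), of i] by auto
      ultimately have "?A $$ (i, p i) = 0"
        using i by auto
      then have "(\<Prod>i = 0..<N. ?A $$ (i, p i)) = 0"
        using i(1) by (intro prod_zero bexI[of _ i]) simp_all
      then show ?thesis
        by (simp only: mult_zero_right)
    qed
    have "det ?A = (\<Sum>p\<in>{p. p permutes {0..<N}}. signof p * (\<Prod>i = 0..<N. ?A $$ (i, p i)))"
      by (rule det_def') simp
    also have "\<dots> = (\<Sum>p\<in>{id}. signof p * (\<Prod>i = 0..<N. ?A $$ (i, p i)))"
      by (rule sum.mono_neutral_right) (use zero in \<open>auto simp: finite_permutations permutes_id\<close>)
    also have "\<dots> = 1"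
      using loop hV by simp
    finally show ?thesis
      using True by simp
  next
    case False
    \<comment> \<open>The indicator of the vertices from which no root is reached lies in the kernel.\<close>
    define S where "S = {v \<in> V. \<nexists>k. root_depth f v k}"
    obtain s where s: "s \<in> S"
      using False forest_fun_if_root_depth[OF f] by (auto simp: S_def)
    define x :: "'b vec" where "x = vec N (\<lambda>i. of_bool (h i \<in> S))"
    \<comment> \<open>Roots lie outside \<open>S\<close>, and any other vertex lies in
      \<open>S\<close> iff its parent does. This is the equation \<open>A x = 0\<close> read row by
      row.\<close>
    have step: "v \<in> S \<longleftrightarrow> (\<exists>u. f v = Some u \<and> u \<in> S)" if v: "v \<in> V" for v
    proof (cases "f v")
      case None
      then show ?thesis
        using root_depth.intros(1)[of f v] by (auto simp: S_def)
    next
      case (Some u)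
      then have "(\<exists>k. root_depth f v k) \<longleftrightarrow> (\<exists>k. root_depth f u k)"
        by (auto simp: root_depth_Some)
      then show ?thesis
        using v Some parent_funsD(1)[OF f v Some] by (auto simp: S_def)
    qed
    have "?A *\<^sub>v x = 0\<^sub>v N"
    proof (intro eq_vecI)
      fix i assume "i < dim_vec (0\<^sub>v N :: 'b vec)"
      then have i: "i < N" by simp
      have "(?A *\<^sub>v x) $ i = (\<Sum>j = 0..<N. (of_bool (i = j) - of_bool (f (h i) = Some (h j))) * of_bool (h j \<in> S))"
        using i by (simp add: scalar_prod_def x_def)
      also have "\<dots> = (\<Sum>j = 0..<N. of_bool (i = j) * of_bool (h j \<in> S))
          - (\<Sum>j = 0..<N. of_bool (f (h i) = Some (h j)) * of_bool (h j \<in> S))"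
        by (simp add: left_diff_distrib sum_subtractf)
      also have "(\<Sum>j = 0..<N. of_bool (i = j) * of_bool (h j \<in> S) :: 'b) = of_bool (h i \<in> S)"
        using i by (subst sum.remove[of _ i]) auto
      also have "(\<Sum>j = 0..<N. of_bool (f (h i) = Some (h j)) * of_bool (h j \<in> S) :: 'b)
          = (\<Sum>v\<in>V. of_bool (f (h i) = Some v) * of_bool (v \<in> S))"
        by (rule sum.reindex_bij_betw[OF h])
      also have "\<dots> = of_bool (h i \<in> S)"
      proof (cases "f (h i)")
        case None
        then show ?thesis
          using step[OF hV[OF i]] by simp
      next
        case (Some u)
        have "finite V" "u \<in> V"
          using bij_betw_finite[OF h] parent_funsD(1)[OF f hV[OF i] Some] by auto
        then show ?thesis
          using step[OF hV[OF i]] Some by (subst sum.remove[of _ u]) auto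
      qed
      finally show "(?A *\<^sub>v x) $ i = 0\<^sub>v N $ i"
        using i by simp
    qed simp
    moreover have "x \<noteq> 0\<^sub>v N"
    proof
      assume x0: "x = 0\<^sub>v N"
      obtain i where "i < N" "h i = s"
        using h s by (auto simp: bij_betw_def S_def image_iff)
      then have "x $ i = 1" "x $ i = 0"
        using s by (simp add: x_def, simp add: x0)
      then show False
        by simp
    qed
    ultimately have "det ?A = 0"
      by (subst det_0_iff_vec_prod_zero[of _ N]) (auto intro!: exI[of _ x] simp: x_def)
    then show ?thesis
      using False by simp
  qed
qed

section \<open>Laplacians and generating polynomials of spanning forests\<close>

definition laplacian :: "(nat \<Rightarrow> 'a) \<Rightarrow> nat \<Rightarrow> 'a set \<Rightarrow> 'a set set \<Rightarrow> 'b :: comm_ring_1 mat" where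
  "laplacian h N V E = mat N N (\<lambda>(i, j).
     if i = j then of_nat (card {u \<in> V. {h i, u} \<in> E}) else - of_bool ({h i, h j} \<in> E))"

text \<open>Row \<open>v\<close> of \<open>x I + L\<close> is \<open>x e\<^sub>v + (\<Sum>u \<sim> v. e\<^sub>v - e\<^sub>u)\<close>; multilinearity in the rows turns the
  determinant into a sum over the choices of one summand for each vertex, that is, over parent
  functions.\<close>

lemma det_laplacian_forests:
  fixes h :: "nat \<Rightarrow> 'a" and x :: "'b :: idom"
  assumes h: "bij_betw h {0..<N} V" and loop_free: "\<And>v. {v} \<notin> E"
  shows "det (x \<cdot>\<^sub>m 1\<^sub>m N + laplacian h N V E)
    = (\<Sum>f | f \<in> parent_funs V E \<and> forest_fun V f. x ^ card (roots V f))"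
proof -
  let ?D = "x \<cdot>\<^sub>m 1\<^sub>m N + laplacian h N V E"
  let ?h' = "the_inv_into {0..<N} h"
  have finV: "finite V"
    using bij_betw_finite[OF h] by simp
  have h': "?h' (h i) = i" if "i < N" for i
    using h that by (simp add: bij_betw_def the_inv_into_f_f)
  have hinj: "h i = h j \<longleftrightarrow> i = j" if "i < N" "j < N" for i j
    using h that by (auto simp: bij_betw_def inj_on_def)
  have hV: "h i \<in> V" if "i < N" for i
    using h that by (auto simp: bij_betw_def)
  let ?opts = "\<lambda>v. insert None (Some ` {u \<in> V. {v, u} \<in> E})"
  \<comment> \<open>\<open>a v c\<close> is the summand of row \<open>v\<close> selected by
    \<open>c\<close>: \<open>x e_v\<close> for \<open>None\<close>, and \<open>e_v - e_u\<close> for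
    \<open>Some u\<close>.\<close>
  define a :: "'a \<Rightarrow> 'a option \<Rightarrow> 'a \<Rightarrow> 'b" where
    "a v c w = (if c = None then x else 1) * (of_bool (v = w) - of_bool (c = Some w))" for v c w
  have entry: "?D $$ (i, j) = (\<Sum>c\<in>?opts (h i). a (h i) c (h j))" if ij: "i < N" "j < N" for i j
  proof -
    have "(\<Sum>c\<in>?opts (h i). a (h i) c (h j))
        = x * of_bool (i = j) + (\<Sum>u | u \<in> V \<and> {h i, u} \<in> E. of_bool (i = j) - of_bool (u = h j))"
      using finV ij by (subst sum.insert) (auto simp: a_def sum.reindex hinj)
    also have "(\<Sum>u | u \<in> V \<and> {h i, u} \<in> E. of_bool (i = j) - of_bool (u = h j) :: 'b)
        = of_nat (card {u \<in> V. {h i, u} \<in> E}) * of_bool (i = j)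
          - (\<Sum>u | u \<in> V \<and> {h i, u} \<in> E. of_bool (u = h j))"
      by (simp add: sum_subtractf)
    also have "(\<Sum>u | u \<in> V \<and> {h i, u} \<in> E. of_bool (u = h j) :: 'b) = of_bool ({h i, h j} \<in> E)"
      using finV hV[OF ij(2)] by (simp add: of_bool_def)
    finally show ?thesis
      using ij loop_free by (auto simp: laplacian_def)
  qed
  let ?P = "{p. p permutes {0..<N}}"
  have "det ?D = (\<Sum>p\<in>?P. signof p * (\<Prod>i = 0..<N. ?D $$ (i, p i)))"
    by (rule det_def') (simp add: laplacian_def)
  also have "\<dots> = (\<Sum>p\<in>?P. \<Sum>f\<in>parent_funs V E. x ^ card (roots V f) *
      (signof p * (\<Prod>i = 0..<N. of_bool (i = p i) - of_bool (f (h i) = Some (h (p i))))))"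
  proof (rule sum.cong[OF refl])
    fix p assume "p \<in> ?P"
    then have p: "p i < N" if "i < N" for i
      using that permutes_in_image[of p "{0..<N}" i] by auto
    \<comment> \<open>Writing \<open>i\<close> as \<open>?h' (h i)\<close> makes each factor a
      function of the vertex \<open>h i\<close>, so the product can be moved to \<open>V\<close> and
      expanded over parent functions.\<close>
    have "(\<Prod>i = 0..<N. ?D $$ (i, p i))
        = (\<Prod>i = 0..<N. \<Sum>c\<in>?opts (h i). a (h i) c (h (p (?h' (h i)))))"
      using p by (intro prod.cong) (auto simp only: entry h' atLeastLessThan_iff)
    also have "\<dots> = (\<Prod>v\<in>V. \<Sum>c\<in>?opts v. a v c (h (p (?h' v))))"
      by (rule prod.reindex_bij_betw[OF h])
    also have "\<dots> = (\<Sum>f\<in>parent_funs V E. \<Prod>v\<in>V. a v (f v) (h (p (?h' v))))"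
      unfolding parent_funs_def using finV by (intro prod_sum_PiE) auto
    also have "\<dots> = (\<Sum>f\<in>parent_funs V E. x ^ card (roots V f) *
      (\<Prod>i = 0..<N. of_bool (i = p i) - of_bool (f (h i) = Some (h (p i)))))"
    proof (rule sum.cong[OF refl])
      fix f
      have "(\<Prod>v\<in>V. a v (f v) (h (p (?h' v)))) = (\<Prod>v\<in>V. if f v = None then x else 1) *
          (\<Prod>v\<in>V. of_bool (v = h (p (?h' v))) - of_bool (f v = Some (h (p (?h' v)))))"
        by (simp only: a_def prod.distrib)
      also have "(\<Prod>v\<in>V. if f v = None then x else 1) = x ^ card (roots V f)"
        using finV by (simp add: prod.If_cases roots_def Int_def)
      also have "(\<Prod>v\<in>V. of_bool (v = h (p (?h' v))) - of_bool (f v = Some (h (p (?h' v)))) :: 'b)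
          = (\<Prod>i = 0..<N. of_bool (h i = h (p (?h' (h i)))) - of_bool (f (h i) = Some (h (p (?h' (h i))))))"
        by (rule prod.reindex_bij_betw[OF h, symmetric])
      also have "\<dots> = (\<Prod>i = 0..<N. of_bool (i = p i) - of_bool (f (h i) = Some (h (p i))))"
        using p by (intro prod.cong) (auto simp: h' hinj)
      finally show "(\<Prod>v\<in>V. a v (f v) (h (p (?h' v)))) = x ^ card (roots V f) *
          (\<Prod>i = 0..<N. of_bool (i = p i) - of_bool (f (h i) = Some (h (p i))))" .
    qed
    finally show "signof p * (\<Prod>i = 0..<N. ?D $$ (i, p i))
      = (\<Sum>f\<in>parent_funs V E. x ^ card (roots V f) *
      (signof p * (\<Prod>i = 0..<N. of_bool (i = p i) - of_bool (f (h i) = Some (h (p i))))))"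
      by (simp add: sum_distrib_left ac_simps)
  qed
  also have "\<dots> = (\<Sum>f\<in>parent_funs V E. x ^ card (roots V f) * (\<Sum>p\<in>?P.
      signof p * (\<Prod>i = 0..<N. of_bool (i = p i) - of_bool (f (h i) = Some (h (p i))))))"
    by (subst sum.swap) (simp add: sum_distrib_left)
  also have "\<dots> = (\<Sum>f\<in>parent_funs V E. x ^ card (roots V f) * of_bool (forest_fun V f))"
  proof (rule sum.cong[OF refl])
    fix f assume f: "f \<in> parent_funs V E"
    let ?A = "mat N N (\<lambda>(i, j). of_bool (i = j) - of_bool (f (h i) = Some (h j))) :: 'b mat"
    \<comment> \<open>For fixed \<open>f\<close> the signed sum is again a Leibniz formula, now for
      the matrix of \<open>f\<close>, whose determinant tests whether \<open>f\<close> is a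
      forest.\<close>
    have "(\<Sum>p\<in>?P. signof p * (\<Prod>i = 0..<N. of_bool (i = p i) - of_bool (f (h i) = Some (h (p i))) :: 'b))
        = (\<Sum>p\<in>?P. signof p * (\<Prod>i = 0..<N. ?A $$ (i, p i)))"
    proof (intro sum.cong prod.cong refl arg_cong2[where f = "(*)"])
      fix p i assume "p \<in> ?P" "i \<in> {0..<N}"
      then show "of_bool (i = p i) - of_bool (f (h i) = Some (h (p i))) = ?A $$ (i, p i)"
        using permutes_in_image[of p "{0..<N}" i] by auto
    qed
    also have "\<dots> = det ?A"
      by (rule det_def'[symmetric]) simp
    finally show "x ^ card (roots V f) * (\<Sum>p\<in>?P.
        signof p * (\<Prod>i = 0..<N. of_bool (i = p i) - of_bool (f (h i) = Some (h (p i)))))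
        = x ^ card (roots V f) * of_bool (forest_fun V f)"
      using det_parent_mat[OF h f loop_free, where 'b = 'b] by simp
  qed
  also have "\<dots> = (\<Sum>f | f \<in> parent_funs V E \<and> forest_fun V f. x ^ card (roots V f))"
    by (rule sum.mono_neutral_cong_right) (use finite_parent_funs[OF finV] in auto)
  finally show ?thesis .
qed

text \<open>With the indeterminate \<open>[:0, 1:]\<close> for \<open>x\<close>, the coefficient of
  degree \<open>k\<close> counts the forests with exactly \<open>k\<close> roots. A forest on a
  nonempty vertex set has at least one root.\<close>

lemma coeff_det_laplacian:
  fixes h :: "nat \<Rightarrow> 'a"
  assumes h: "bij_betw h {0..<N} V" and loop_free: "\<And>v. {v} \<notin> E" and "V \<noteq> {}"
  defines "P \<equiv> det ([:0, 1:] \<cdot>\<^sub>m 1\<^sub>m N + laplacian h N V E) :: int poly"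
  shows "coeff P 0 = 0" and "coeff P 1 = int (card (tree_funs V E))"
proof -
  have finV: "finite V"
    using bij_betw_finite[OF h] by simp
  let ?F = "{f. f \<in> parent_funs V E \<and> forest_fun V f}"
  have P: "P = (\<Sum>f\<in>?F. [:0, 1:] ^ card (roots V f))"
    unfolding P_def by (rule det_laplacian_forests[OF h loop_free])
  have fin: "finite ?F"
    using finite_parent_funs[OF finV] by simp
  have coeff: "coeff P k = (\<Sum>f\<in>?F. of_bool (card (roots V f) = k))" for k
    unfolding P coeff_sum
    by (intro sum.cong) (auto simp: monom_altdef[of "1::int", simplified, symmetric])
  have "card (roots V f) \<noteq> 0" if "f \<in> ?F" for f
    using that forest_fun_roots_nonempty[of f V E] finV assms(3) by (auto simp: roots_def)
  then show "coeff P 0 = 0"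
    unfolding coeff by (intro sum.neutral) auto
  have "coeff P 1 = int (card (?F \<inter> {f. card (roots V f) = 1}))"
    unfolding coeff using fin by (simp add: of_bool_def sum.If_cases)
  also have "?F \<inter> {f. card (roots V f) = 1} = tree_funs V E"
    by (auto simp: tree_funs_def)
  finally show "coeff P 1 = int (card (tree_funs V E))" .
qed

section \<open>Neighbouring levels of the subset lattice\<close>

text \<open>\<open>A\<close> is the incidence matrix of \<open>R\<close>, so the entries of
  \<open>A A^T\<close> count common neighbours in \<open>U\<close>: adjacency in \<open>E\<close>
  off the diagonal and \<open>b\<close> on it. It remains to see that every vertex has degree
  \<open>a * b - b\<close>.\<close>

lemma laplacian_eq_gram:
  fixes h :: "nat \<Rightarrow> 'a" and g :: "nat \<Rightarrow> 'b" and x :: "'c :: comm_ring_1"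
  assumes h: "bij_betw h {0..<N} V" and g: "bij_betw g {0..<M} U"
    and loop_free: "\<And>v. {v} \<notin> E"
    and degV: "\<And>v. v \<in> V \<Longrightarrow> card {u \<in> U. R v u} = b"
    and degU: "\<And>u. u \<in> U \<Longrightarrow> card {v \<in> V. R v u} = a"
    and common: "\<And>v w. v \<in> V \<Longrightarrow> w \<in> V \<Longrightarrow> v \<noteq> w \<Longrightarrow>
      card {u \<in> U. R v u \<and> R w u} = of_bool ({v, w} \<in> E)"
  defines "A \<equiv> mat N M (\<lambda>(i, j). of_bool (R (h i) (g j)))"
  shows "x \<cdot>\<^sub>m 1\<^sub>m N + laplacian h N V E = (x + of_nat (a * b)) \<cdot>\<^sub>m 1\<^sub>m N - A * transpose_mat A"
proof -
  have fin: "finite V" "finite U"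
    using bij_betw_finite[OF h] bij_betw_finite[OF g] by simp_all
  have hV: "h i \<in> V" if "i < N" for i
    using h that by (auto simp: bij_betw_def)
  have hinj: "h i = h j \<longleftrightarrow> i = j" if "i < N" "j < N" for i j
    using h that by (auto simp: bij_betw_def inj_on_def)
  have gram: "(A * transpose_mat A) $$ (i, j) = of_nat (card {u \<in> U. R (h i) u \<and> R (h j) u})"
    if "i < N" "j < N" for i j
  proof -
    have "(A * transpose_mat A) $$ (i, j)
        = (\<Sum>l = 0..<M. of_bool (R (h i) (g l) \<and> R (h j) (g l)))"
      using that by (simp add: A_def scalar_prod_def of_bool_conj)
    also have "\<dots> = (\<Sum>u\<in>U. of_bool (R (h i) u \<and> R (h j) u))"
      by (rule sum.reindex_bij_betw[OF g])
    also have "\<dots> = of_nat (card {u \<in> U. R (h i) u \<and> R (h j) u})"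
      using fin(2) by (simp add: of_bool_def sum.If_cases Int_def)
    finally show ?thesis .
  qed
  \<comment> \<open>Double counting of the pairs \<open>(w, u)\<close> with \<open>R v u\<close> and
    \<open>R w u\<close>: there are \<open>a * b\<close>, of which \<open>b\<close> have
    \<open>w = v\<close>, and each neighbour \<open>w\<close> of \<open>v\<close> contributes
    one.\<close>
  have deg: "card {w \<in> V. {v, w} \<in> E} + b = a * b" if v: "v \<in> V" for v
  proof -
    have "(\<Sum>w\<in>V. card {u \<in> U. R v u \<and> R w u})
        = card {u \<in> U. R v u \<and> R v u} + (\<Sum>w\<in>V - {v}. card {u \<in> U. R v u \<and> R w u})"
      using fin(1) v by (rule sum.remove)
    also have "(\<Sum>w\<in>V - {v}. card {u \<in> U. R v u \<and> R w u}) = (\<Sum>w\<in>V - {v}. of_bool ({v, w} \<in> E))"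
      using common v by (intro sum.cong) auto
    also have "\<dots> = card {w \<in> V - {v}. {v, w} \<in> E}"
      using fin(1) by (simp add: of_bool_def sum.If_cases Int_def)
    also have "{w \<in> V - {v}. {v, w} \<in> E} = {w \<in> V. {v, w} \<in> E}"
      using loop_free by auto
    finally have 1: "(\<Sum>w\<in>V. card {u \<in> U. R v u \<and> R w u}) = b + card {w \<in> V. {v, w} \<in> E}"
      using degV[OF v] by simp
    have 2: "(\<Sum>w\<in>V. card {u \<in> {u \<in> U. R v u}. R w u}) = a * card {u \<in> U. R v u}"
      using fin degU by (intro sum_multicount) auto
    have 3: "{u \<in> {u \<in> U. R v u}. R w u} = {u \<in> U. R v u \<and> R w u}" for w
      by auto
    show ?thesis
      using 1 2[unfolded 3] unfolding degV[OF v] by linarith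
  qed
  show ?thesis
  proof (rule eq_matI)
    fix i j
    assume "i < dim_row ((x + of_nat (a * b)) \<cdot>\<^sub>m 1\<^sub>m N - A * transpose_mat A)"
      and "j < dim_col ((x + of_nat (a * b)) \<cdot>\<^sub>m 1\<^sub>m N - A * transpose_mat A)"
    then have ij: "i < N" "j < N"
      by (auto simp: A_def)
    have rhs: "((x + of_nat (a * b)) \<cdot>\<^sub>m 1\<^sub>m N - A * transpose_mat A) $$ (i, j)
        = (x + of_nat (a * b)) * of_bool (i = j) - of_nat (card {u \<in> U. R (h i) u \<and> R (h j) u})"
      using ij gram[OF ij] by (simp add: A_def del: index_mult_mat(1))
    show "(x \<cdot>\<^sub>m 1\<^sub>m N + laplacian h N V E) $$ (i, j)
        = ((x + of_nat (a * b)) \<cdot>\<^sub>m 1\<^sub>m N - A * transpose_mat A) $$ (i, j)"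
    proof (cases "i = j")
      case True
      then show ?thesis
        unfolding rhs using ij degV[OF hV[OF ij(1)]] deg[OF hV[OF ij(1)], symmetric]
        by (simp add: laplacian_def del: of_nat_mult)
    next
      case False
      then show ?thesis
        unfolding rhs using ij hinj common[OF hV[OF ij(1)] hV[OF ij(2)]]
        by (simp add: laplacian_def)
    qed
  qed (simp_all add: laplacian_def A_def)
qed

text \<open>Applied to \<open>R\<close> and to its converse, the Gram formula involves
  \<open>A A^T\<close> and \<open>A^T A\<close> with the same \<open>y\<close>, so the Sylvester
  identity links the two forest polynomials.\<close>

lemma card_tree_funs_bipartite:
  fixes V :: "'a set" and U :: "'b set"
  assumes fin: "finite V" "finite U" and ne: "V \<noteq> {}" "U \<noteq> {}"
    and loop_free: "\<And>v. {v} \<notin> E" "\<And>u. {u} \<notin> E'"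
    and degV: "\<And>v. v \<in> V \<Longrightarrow> card {u \<in> U. R v u} = b"
    and degU: "\<And>u. u \<in> U \<Longrightarrow> card {v \<in> V. R v u} = a"
    and commonV: "\<And>v w. v \<in> V \<Longrightarrow> w \<in> V \<Longrightarrow> v \<noteq> w \<Longrightarrow>
      card {u \<in> U. R v u \<and> R w u} = of_bool ({v, w} \<in> E)"
    and commonU: "\<And>u t. u \<in> U \<Longrightarrow> t \<in> U \<Longrightarrow> u \<noteq> t \<Longrightarrow>
      card {v \<in> V. R v u \<and> R v t} = of_bool ({u, t} \<in> E')"
  shows "card (tree_funs V E) * (a * b) ^ card U = card (tree_funs U E') * (a * b) ^ card V"
proof -
  obtain h where h: "bij_betw h {0..<card V} V"
    using ex_bij_betw_nat_finite[OF fin(1)] by blast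
  obtain g where g: "bij_betw g {0..<card U} U"
    using ex_bij_betw_nat_finite[OF fin(2)] by blast
  define X :: "int poly" where "X = [:0, 1:]"
  define A :: "int poly mat" where
    "A = mat (card V) (card U) (\<lambda>(i, j). of_bool (R (h i) (g j)))"
  define y where "y = X + of_nat (a * b)"
  define P where "P = det (X \<cdot>\<^sub>m 1\<^sub>m (card V) + laplacian h (card V) V E)"
  define Q where "Q = det (X \<cdot>\<^sub>m 1\<^sub>m (card U) + laplacian g (card U) U E')"
  have A: "A \<in> carrier_mat (card V) (card U)"
    by (simp add: A_def)
  have P: "P = det (y \<cdot>\<^sub>m 1\<^sub>m (card V) - A * transpose_mat A)"
    unfolding P_def y_def A_def
    by (subst laplacian_eq_gram[where R = R, OF h g loop_free(1) degV degU commonV]) auto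
  have AT: "mat (card U) (card V) (\<lambda>(j, i). of_bool (R (h i) (g j))) = transpose_mat A"
    by (auto simp: A_def)
  have Q: "Q = det (y \<cdot>\<^sub>m 1\<^sub>m (card U) - transpose_mat A * A)"
    unfolding Q_def y_def
    by (subst laplacian_eq_gram[where R = "\<lambda>u v. R v u", OF g h loop_free(2) degU degV commonU])
      (auto simp: AT mult.commute)
  have PQ: "P * y ^ card U = Q * y ^ card V"
    unfolding P Q using A by (intro det_sylvester) auto
  have y0: "coeff (y ^ k) 0 = int ((a * b) ^ k)" for k
    by (simp add: coeff_0_power y_def X_def of_nat_poly del: of_nat_mult)
  \<comment> \<open>As \<open>P\<close> has constant coefficient 0, only its linear coefficient
    times the constant coefficient \<open>(a * b) ^ card U\<close> of the power remains.\<close>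
  have "coeff (P * y ^ card U) 1 = int (card (tree_funs V E) * (a * b) ^ card U)"
    using coeff_det_laplacian[OF h loop_free(1) ne(1)]
    by (simp add: coeff_mult y0 P_def X_def)
  moreover have "coeff (Q * y ^ card V) 1 = int (card (tree_funs U E') * (a * b) ^ card V)"
    using coeff_det_laplacian[OF g loop_free(2) ne(2)]
    by (simp add: coeff_mult y0 Q_def X_def)
  ultimately show ?thesis
    using PQ by (simp only: of_nat_eq_iff)
qed

section \<open>Counting subsets and supersets in adjacent levels\<close>

lemma finite_B: "finite (B n k)"
  by (auto simp: B_def)

lemma finite_B_mem: "X \<in> B n k \<Longrightarrow> finite X"
  by (auto simp: B_def intro: finite_subset)

lemma card_B_subsets:
  assumes "X \<in> B n j"
  shows "card {Y \<in> B n k. Y \<subseteq> X} = j choose k"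
proof -
  have "{Y \<in> B n k. Y \<subseteq> X} = {Y. Y \<subseteq> X \<and> card Y = k}"
    using assms by (auto simp: B_def)
  then show ?thesis
    using n_subsets[OF finite_B_mem[OF assms], of k] assms by (simp add: B_def)
qed

lemma card_B_subsets_pred:
  assumes "X \<in> B n m" "1 \<le> m"
  shows "card {Y \<in> B n (m - 1). Y \<subseteq> X} = m"
proof -
  obtain k where "m = Suc k"
    using assms(2) by (cases m) auto
  then show ?thesis
    using card_B_subsets[OF assms(1), of k] by simp
qed

lemma card_B_supersets:
  assumes "X \<in> B n (m - 1)" "1 \<le> m"
  shows "card {Y \<in> B n m. X \<subseteq> Y} = n - (m - 1)"
proof -
  have X: "X \<subseteq> {1..n}" "card X = m - 1" "finite X"
    using assms(1) finite_B_mem[OF assms(1)] by (auto simp: B_def)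
  have "{Y \<in> B n m. X \<subseteq> Y} = (\<lambda>a. insert a X) ` ({1..n} - X)"
  proof (intro equalityI subsetI)
    fix Y assume "Y \<in> {Y \<in> B n m. X \<subseteq> Y}"
    then have Y: "Y \<subseteq> {1..n}" "card Y = m" "X \<subseteq> Y"
      by (auto simp: B_def)
    then have "card (Y - X) = 1"
      using X assms(2) by (simp add: card_Diff_subset)
    then obtain a where "Y - X = {a}"
      by (auto simp: card_1_singleton_iff)
    with Y show "Y \<in> (\<lambda>a. insert a X) ` ({1..n} - X)"
      by (intro image_eqI[of _ _ a]) auto
  qed (use X assms(2) in \<open>auto simp: B_def\<close>)
  moreover have "inj_on (\<lambda>a. insert a X) ({1..n} - X)"
    by (auto intro!: inj_onI)
  ultimately show ?thesis
    using X by (simp add: card_image card_Diff_subset)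
qed

text \<open>The successor form stays within the natural numbers and still excludes all edges for
  \<open>m = 0\<close>.\<close>

lemma johnson_edge_iff:
  assumes "X \<in> B n m" "Y \<in> B n m"
  shows "{X, Y} \<in> johnson_edges n m \<longleftrightarrow> Suc (card (X \<inter> Y)) = m"
proof
  assume "{X, Y} \<in> johnson_edges n m"
  then show "Suc (card (X \<inter> Y)) = m"
    by (auto simp: johnson_edges_def doubleton_eq_iff Int_commute)
next
  assume "Suc (card (X \<inter> Y)) = m"
  with assms show "{X, Y} \<in> johnson_edges n m"
    unfolding johnson_edges_def by (intro CollectI exI[of _ X] exI[of _ Y]) auto
qed

text \<open>The common subsets are the \<open>(m - 1)\<close>-subsets of
  \<open>X \<inter> Y\<close>, which has fewer than \<open>m\<close> elements: there is one if its
  size is \<open>m - 1\<close> and none otherwise.\<close>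

lemma card_common_subsets:
  assumes X: "X \<in> B n m" and Y: "Y \<in> B n m" and neq: "X \<noteq> Y"
  shows "card {Z \<in> B n (m - 1). Z \<subseteq> X \<and> Z \<subseteq> Y} = of_bool ({X, Y} \<in> johnson_edges n m)"
proof -
  have fin: "finite X" "finite Y" and card: "card X = m" "card Y = m"
    using X Y finite_B_mem[OF X] finite_B_mem[OF Y] by (auto simp: B_def)
  have "X \<inter> Y \<in> B n (card (X \<inter> Y))"
    using X by (auto simp: B_def)
  from card_B_subsets[OF this, of "m - 1"]
  have "card {Z \<in> B n (m - 1). Z \<subseteq> X \<and> Z \<subseteq> Y} = card (X \<inter> Y) choose (m - 1)"
    by simp
  moreover have "X \<inter> Y \<subset> X"
    using neq fin card by (metis Int_lower1 Int_lower2 card_subset_eq inf.absorb_iff1 psubsetI)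
  then have "card (X \<inter> Y) < m"
    using psubset_card_mono[OF fin(1)] card by simp
  ultimately show ?thesis
    unfolding johnson_edge_iff[OF X Y]
    by (cases "card (X \<inter> Y) = m - 1") (auto simp: binomial_eq_0)
qed

text \<open>A common superset contains \<open>X \<union> Y\<close>, which has at least
  \<open>m\<close> elements, so only the union itself can qualify. It has size \<open>m\<close>
  exactly when the intersection has size \<open>m - 2\<close>.\<close>

lemma card_common_supersets:
  assumes X: "X \<in> B n (m - 1)" and Y: "Y \<in> B n (m - 1)" and neq: "X \<noteq> Y" and m: "1 \<le> m"
  shows "card {Z \<in> B n m. X \<subseteq> Z \<and> Y \<subseteq> Z} = of_bool ({X, Y} \<in> johnson_edges n (m - 1))"
proof -
  have fin: "finite X" "finite Y" and card: "card X = m - 1" "card Y = m - 1"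
    using X Y finite_B_mem[OF X] finite_B_mem[OF Y] by (auto simp: B_def)
  have sum: "card (X \<union> Y) + card (X \<inter> Y) = 2 * (m - 1)"
    using card_Un_Int[OF fin] card by simp
  have "X \<subset> X \<union> Y"
    using neq fin card by (metis Un_upper1 card_subset_eq psubsetI subset_Un_eq sup.commute)
  then have "m - 1 < card (X \<union> Y)"
    using psubset_card_mono[of "X \<union> Y" X] fin card by simp
  show ?thesis
  proof (cases "card (X \<union> Y) = m")
    case True
    have "{Z \<in> B n m. X \<subseteq> Z \<and> Y \<subseteq> Z} = {X \<union> Y}"
    proof (intro equalityI subsetI)
      fix Z assume "Z \<in> {Z \<in> B n m. X \<subseteq> Z \<and> Y \<subseteq> Z}"
      then have "X \<union> Y \<subseteq> Z" "card Z = m" "finite Z"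
        using finite_B_mem[of Z n m] by (auto simp: B_def)
      with True show "Z \<in> {X \<union> Y}"
        using card_subset_eq[of Z "X \<union> Y"] by simp
    qed (use True X Y in \<open>auto simp: B_def\<close>)
    with True sum m show ?thesis
      unfolding johnson_edge_iff[OF X Y] by auto
  next
    case False
    with \<open>m - 1 < card (X \<union> Y)\<close> have "m < card (X \<union> Y)"
      by simp
    moreover have "card (X \<union> Y) \<le> m" if "Z \<in> B n m" "X \<subseteq> Z" "Y \<subseteq> Z" for Z
      using that card_mono[OF finite_B_mem[OF that(1)], of "X \<union> Y"] by (auto simp: B_def)
    ultimately have empty: "{Z \<in> B n m. X \<subseteq> Z \<and> Y \<subseteq> Z} = {}"
      by fastforce
    have "Suc (card (X \<inter> Y)) \<noteq> m - 1"
      using sum \<open>m < card (X \<union> Y)\<close> by simp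
    then show ?thesis
      unfolding johnson_edge_iff[OF X Y] empty by simp
  qed
qed

text \<open>Going down removes one of \<open>m\<close> elements; going up adds one of the
  \<open>n - (m - 1)\<close> elements outside.\<close>

lemma card_UD:
  assumes "X \<in> B n m" "1 \<le> m"
  shows "card (UD n m X) = m * (n - (m - 1))"
proof -
  have "UD n m X = (SIGMA Y : {Y \<in> B n (m - 1). Y \<subseteq> X}. {Z \<in> B n m. Y \<subseteq> Z})"
    by (auto simp: UD_def)
  then have "card (UD n m X) = (\<Sum>Y | Y \<in> B n (m - 1) \<and> Y \<subseteq> X. card {Z \<in> B n m. Y \<subseteq> Z})"
    by (simp add: finite_B)
  also have "\<dots> = (\<Sum>Y | Y \<in> B n (m - 1) \<and> Y \<subseteq> X. n - (m - 1))"
    using card_B_supersets[OF _ assms(2)] by (intro sum.cong) auto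
  also have "\<dots> = m * (n - (m - 1))"
    by (simp only: sum_constant card_B_subsets_pred[OF assms] of_nat_id)
  finally show ?thesis .
qed

lemma card_DU:
  assumes "X \<in> B n (m - 1)" "1 \<le> m"
  shows "card (DU n m X) = m * (n - (m - 1))"
proof -
  have "DU n m X = (SIGMA Y : {Y \<in> B n m. X \<subseteq> Y}. {Z \<in> B n (m - 1). Z \<subseteq> Y})"
    by (auto simp: DU_def)
  then have "card (DU n m X) = (\<Sum>Y | Y \<in> B n m \<and> X \<subseteq> Y. card {Z \<in> B n (m - 1). Z \<subseteq> Y})"
    by (simp add: finite_B)
  also have "\<dots> = (\<Sum>Y | Y \<in> B n m \<and> X \<subseteq> Y. m)"
    using card_B_subsets_pred[OF _ assms(2)] by (intro sum.cong) auto
  also have "\<dots> = (n - (m - 1)) * m"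
    by (simp only: sum_constant card_B_supersets[OF assms] of_nat_id)
  finally show ?thesis
    by (simp only: mult.commute)
qed

section \<open>The Johnson graphs and the final count\<close>

lemma johnson_edges_loop_free: "{v} \<notin> johnson_edges n m"
  using card_johnson_edge(2)[of "{v}" n m] by auto

lemma card_T: "card (T n m) = card (tree_funs (B n m) (johnson_edges n m))"
  unfolding T_def by (rule card_rooted_spanning_trees) (simp add: card_johnson_edge)

lemma finite_T: "finite (T n m)"
proof (rule finite_subset)
  show "T n m \<subseteq> Pow (Pow (B n m)) \<times> B n m"
    using card_johnson_edge(1)
    by (fastforce simp: T_def rooted_spanning_trees_def spanning_tree_def)
qed (simp add: finite_B)

theorem theorem3p4:
  fixes n m :: nat
  assumes "1 \<le> m" and "2 * m \<le> n"
  shows "T n m \<times> (\<Pi>\<^sub>E X \<in> B n (m - 1). DU n m X) \<approx> T n (m - 1) \<times> (\<Pi>\<^sub>E X \<in> B n m. UD n m X)"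
proof -
  have ne: "B n k \<noteq> {}" if "k \<le> n" for k
    using that obtain_subset_with_card_n[of k "{1..n}"] by (auto simp: B_def)
  have trees: "card (T n m) * ((n - (m - 1)) * m) ^ card (B n (m - 1))
      = card (T n (m - 1)) * ((n - (m - 1)) * m) ^ card (B n m)"
    unfolding card_T
  \<comment> \<open>The relation is inclusion between the levels \<open>m\<close> and
    \<open>m - 1\<close>, with \<open>b = m\<close> and \<open>a = n - (m - 1)\<close>.\<close>
  proof (rule card_tree_funs_bipartite[where R = "\<lambda>v u. u \<subseteq> v"])
    show "B n m \<noteq> {}" "B n (m - 1) \<noteq> {}"
      using assms by (simp_all add: ne)
  qed (fact finite_B johnson_edges_loop_free card_B_subsets_pred[OF _ assms(1)]
      card_B_supersets[OF _ assms(1)] card_common_subsets card_common_supersets[OF _ _ _ assms(1)])+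
  have DU: "card (\<Pi>\<^sub>E X \<in> B n (m - 1). DU n m X) = (m * (n - (m - 1))) ^ card (B n (m - 1))"
    using card_DU[OF _ assms(1)] by (simp add: card_PiE finite_B)
  have UD: "card (\<Pi>\<^sub>E X \<in> B n m. UD n m X) = (m * (n - (m - 1))) ^ card (B n m)"
    using card_UD[OF _ assms(1)] by (simp add: card_PiE finite_B)
  \<comment> \<open>Equal cardinalities yield equipollence only once both sides are known to be
    finite.\<close>
  have "finite (DU n m X)" for X
    by (rule finite_subset[of _ "B n m \<times> B n (m - 1)"]) (auto simp: DU_def finite_B)
  moreover have "finite (UD n m X)" for X
    by (rule finite_subset[of _ "B n (m - 1) \<times> B n m"]) (auto simp: UD_def finite_B)
  ultimately have "finite (T n m \<times> (\<Pi>\<^sub>E X \<in> B n (m - 1). DU n m X))"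
    "finite (T n (m - 1) \<times> (\<Pi>\<^sub>E X \<in> B n m. UD n m X))"
    by (simp_all add: finite_T finite_PiE finite_B)
  moreover have "card (T n m \<times> (\<Pi>\<^sub>E X \<in> B n (m - 1). DU n m X))
      = card (T n (m - 1) \<times> (\<Pi>\<^sub>E X \<in> B n m. UD n m X))"
    unfolding card_cartesian_product DU UD using trees by (simp only: mult.commute[of m])
  ultimately show ?thesis
    by (simp only: eqpoll_iff_card)
qed

end
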